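(* For integers $k\ge 2$ and $l\ge 1$, let $W_{l, 0}(x, k), W_{l, 1}(x, k), \ldots, W_{l, l+1}(x, k)$ be the sequence of polynomials in $x$ defined by \begin{align*} W_{l, 0}(x, k) &= 1,\\ W_{l, 1}(x, k) &= x,\\ W_{l, j}(x, k) &= x\, W_{l, j-1}(x, k) - (k-1)\, W_{l, j-2}(x, k) \quad \text{for all } 2 \le j \le l,\\ W_{l, l+1}(x, k) &= x\, W_{l,l}(x, k) - k\, W_{l, l-1}(x, k). \end{align*} Then, for all $k \ge 2$ and $l \ge 1$, $$P_x(d(l, k)) = W_{l, l+1}(x, k)\, W_{l,l}(x, k)^{k-1} \prod_{j = 1}^{l-1} W_{l, j}(x, k)^{k(k-2)(k-1)^{l-1-j}} .$$
   Context: For a finite simple graph $G$ with adjacency matrix $A(G)$, $P_x(G)=\det(xI-A(G))$ is the characteristic polynomial. For integers $l\ge 1$ and $k\ge 2$, the dendrimer $d(l,k)$ is the rooted tree with $l+1$ levels numbered $0,\dots,l$ (level $0$ consists of the root, level $l$ consists of the leaves) in which every vertex in levels $0,\dots,l-1$ (the internal vertices) has degree $k$; i.e. the root has $k$ children, every vertex in levels $1,\dots,l-1$ has $k-1$ children, and vertices in level $l$ have no children. *)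

theory Defs
  imports
    "Graph_Theory.Digraph_Component"
    "Jordan_Normal_Form.Char_Poly"
begin

text \<open>
  Finite simple graphs are the structures satisfying the locale \<^locale>\<open>pair_graph\<close>: finite,
  loop-free and symmetric digraphs, an undirected edge being a pair of opposite arcs. The
  adjacency matrix depends on an enumeration \<open>vs\<close> of the vertices, i.e. a list with
  \<^prop>\<open>distinct vs\<close> and \<^prop>\<open>set vs = pverts G\<close>.
\<close>

definition adjacency_matrix :: "'a pair_pre_digraph \<Rightarrow> 'a list \<Rightarrow> real mat" where
  "adjacency_matrix G vs =
     mat (length vs) (length vs) (\<lambda>(i, j). if (vs ! i, vs ! j) \<in> parcs G then 1 else 0)"

text \<open>
  A vertex of the dendrimer is the list of choices of a child made on the path from the root
  (the empty list) to it, so that its level is the length of the list.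
\<close>

definition dendrimer_verts :: "nat \<Rightarrow> nat \<Rightarrow> nat list set" where
  "dendrimer_verts l k =
     {v. length v \<le> l \<and> (\<forall>i < length v. v ! i < (if i = 0 then k else k - 1))}"

text \<open>The arcs of the rooted tree lead from parents to children.\<close>

definition rooted_dendrimer :: "nat \<Rightarrow> nat \<Rightarrow> nat list pair_pre_digraph" where
  "rooted_dendrimer l k =
     \<lparr> pverts = dendrimer_verts l k,
       parcs = {(u, v). u \<in> dendrimer_verts l k \<and> v \<in> dendrimer_verts l k \<and> (\<exists>c. v = u @ [c])} \<rparr>"

definition dendrimer :: "nat \<Rightarrow> nat \<Rightarrow> nat list pair_pre_digraph" where
  "dendrimer l k = mk_symmetric (with_proj (rooted_dendrimer l k))"

text \<open>Only the values for \<open>j \<le> l + 1\<close> are meaningful.\<close>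

fun W :: "nat \<Rightarrow> nat \<Rightarrow> nat \<Rightarrow> real poly" where
  "W l k 0 = 1"
| "W l k (Suc 0) = [:0, 1:]"
| "W l k (Suc (Suc j)) =
     (if Suc (Suc j) \<le> l
      then [:0, 1:] * W l k (Suc j) - (of_nat k - 1) * W l k j
      else [:0, 1:] * W l k (Suc j) - of_nat k * W l k j)"

lemma W_step:
  "2 \<le> j \<Longrightarrow> j \<le> l \<Longrightarrow> W l k j = [:0, 1:] * W l k (j - 1) - (of_nat k - 1) * W l k (j - 2)"
  by (cases "(l, k, j)" rule: W.cases) auto

lemma W_last:
  "1 \<le> l \<Longrightarrow> W l k (l + 1) = [:0, 1:] * W l k l - of_nat k * W l k (l - 1)"
  by (cases l) auto

text \<open>The remaining lemmas confirm that the list encoding has the intended shape.\<close>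

lemma Nil_dendrimer_verts [simp]: "[] \<in> dendrimer_verts l k"
  by (simp add: dendrimer_verts_def)

lemma snoc_dendrimer_verts:
  "v @ [c] \<in> dendrimer_verts l k \<longleftrightarrow>
     v \<in> dendrimer_verts l k \<and> length v < l \<and> c < (if v = [] then k else k - 1)"
  by (auto simp: dendrimer_verts_def nth_append less_Suc_eq)

lemma finite_dendrimer_verts: "finite (dendrimer_verts l k)"
proof -
  have "v ! i < k" if "v \<in> dendrimer_verts l k" "i < length v" for v i
  proof -
    have "v ! i < (if i = 0 then k else k - 1)"
      using that by (simp add: dendrimer_verts_def)
    then show ?thesis by (cases "i = 0") simp_all
  qed
  then have "dendrimer_verts l k \<subseteq> {v. set v \<subseteq> {..<k} \<and> length v \<le> l}"
    by (fastforce simp: in_set_conv_nth dendrimer_verts_def)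
  then show ?thesis
    by (rule finite_subset) (simp add: finite_lists_length_le)
qed

lemma rooted_dendrimer_arcs:
  "(u, w) \<in> parcs (rooted_dendrimer l k) \<longleftrightarrow>
     w \<in> dendrimer_verts l k \<and> (\<exists>c. w = u @ [c])"
proof -
  have "u \<in> dendrimer_verts l k" if "w \<in> dendrimer_verts l k" "w = u @ [c]" for c
    using that by (simp only: snoc_dendrimer_verts)
  then show ?thesis
    unfolding rooted_dendrimer_def pair_pre_digraph.simps mem_Collect_eq prod.case by iprover
qed

lemma pverts_dendrimer [simp]: "pverts (dendrimer l k) = dendrimer_verts l k"
  by (simp only: dendrimer_def pverts_mk_symmetric with_proj_simps rooted_dendrimer_def
      pair_pre_digraph.simps)

lemma parcs_dendrimer:
  "(u, w) \<in> parcs (dendrimer l k) \<longleftrightarrow>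
     (u, w) \<in> parcs (rooted_dendrimer l k) \<or> (w, u) \<in> parcs (rooted_dendrimer l k)"
proof -
  have "(u, w) \<in> (\<Union>e\<in>R. {(fst e, snd e), (snd e, fst e)}) \<longleftrightarrow>
      (u, w) \<in> R \<or> (w, u) \<in> R" for R :: "(nat list \<times> nat list) set"
  proof -
    have "(u, w) \<in> {(fst e, snd e), (snd e, fst e)} \<longleftrightarrow> e = (u, w) \<or> e = (w, u)" for e
      by (cases e) (simp, iprover)
    then show ?thesis unfolding UN_iff Bex_def by iprover
  qed
  then show ?thesis
    by (simp only: dendrimer_def parcs_mk_symmetric with_proj_simps)
qed

lemma parcs_dendrimer_subset:
  "parcs (dendrimer l k) \<subseteq> dendrimer_verts l k \<times> dendrimer_verts l k"
proof (rule subrelI)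
  fix u w assume "(u, w) \<in> parcs (dendrimer l k)"
  then show "(u, w) \<in> dendrimer_verts l k \<times> dendrimer_verts l k"
    by (auto simp: parcs_dendrimer rooted_dendrimer_def)
qed

lemma pair_graph_dendrimer: "pair_graph (dendrimer l k)"
proof
  show "finite (pverts (dendrimer l k))"
    by (simp add: finite_dendrimer_verts)
  show "finite (parcs (dendrimer l k))"
    by (rule finite_subset[OF parcs_dendrimer_subset]) (simp add: finite_dendrimer_verts)
  show "symmetric (with_proj (dendrimer l k))"
    by (simp add: symmetric_def sym_def parcs_dendrimer disj_commute)
next
  fix e assume "e \<in> parcs (dendrimer l k)"
  moreover obtain u w where "e = (u, w)" by (cases e)
  ultimately have uw: "(u, w) \<in> parcs (dendrimer l k)" "e = (u, w)" by simp_all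
  from uw(1) show "fst e \<noteq> snd e"
    by (auto simp: uw(2) parcs_dendrimer rooted_dendrimer_arcs)
  from uw(1) parcs_dendrimer_subset[of l k]
  show "fst e \<in> pverts (dendrimer l k)" "snd e \<in> pverts (dendrimer l k)"
    by (simp_all add: uw(2)) blast+
qed

text \<open>
  \<^const>\<open>tree\<close> is meant for oriented trees: in a symmetric digraph any pair of opposite arcs counts
  as a cycle.
\<close>

lemma tree_rooted_dendrimer: "tree (with_proj (rooted_dendrimer l k))"
proof -
  let ?T = "rooted_dendrimer l k"
  have pverts: "pverts ?T = dendrimer_verts l k"
    by (simp only: rooted_dendrimer_def pair_pre_digraph.simps)
  interpret T: pair_wf_digraph ?T
    by unfold_locales (simp_all add: rooted_dendrimer_def split_beta)
  interpret G: pair_graph "dendrimer l k" by (rule pair_graph_dendrimer)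
  have from_root: "[] \<rightarrow>\<^sup>*\<^bsub>with_proj (dendrimer l k)\<^esub> v" if "v \<in> dendrimer_verts l k" for v
    using that
  proof (induction v rule: rev_induct)
    case Nil
    then show ?case by (simp add: G.reachable_refl)
  next
    case (snoc c v)
    then have "(v, v @ [c]) \<in> parcs (dendrimer l k)" and "v \<in> dendrimer_verts l k"
      by (simp_all add: parcs_dendrimer rooted_dendrimer_arcs snoc_dendrimer_verts)
    with snoc.IH show ?case by (meson G.reachable_adj_trans with_proj_simps(3))
  qed
  have "connected (with_proj ?T)"
  proof (rule T.connectedI)
    show "pverts ?T \<noteq> {}"
      using Nil_dendrimer_verts pverts by blast
  next
    fix u v assume "u \<in> pverts ?T" "v \<in> pverts ?T"
    then have "[] \<rightarrow>\<^sup>*\<^bsub>with_proj (dendrimer l k)\<^esub> u" "[] \<rightarrow>\<^sup>*\<^bsub>with_proj (dendrimer l k)\<^esub> v"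
      unfolding pverts by (simp_all only: from_root)
    then show "u \<rightarrow>\<^sup>*\<^bsub>with_proj (mk_symmetric (with_proj ?T))\<^esub> v"
      unfolding dendrimer_def[symmetric]
      by (metis G.reachable_trans symmetric_reachable G.pair_sym_arcs)
  qed
  moreover have len: "length v = length u + length p" if "T.awalk u p v" for u p v
    using that
  proof (induction p arbitrary: u)
    case Nil
    then show ?case by (simp add: T.awalk_simps)
  next
    case (Cons e p)
    obtain a b where e: "e = (a, b)" by (cases e)
    from Cons.prems have "(a, b) \<in> parcs ?T" "a = u" "T.awalk b p v"
      by (simp_all add: T.awalk_simps e)
    with Cons.IH[of b] show ?case by (auto simp: rooted_dendrimer_arcs)
  qed
  have "forest (with_proj ?T)"
    unfolding forest_def T.cycle_def using len by fastforce
  ultimately show ?thesis by (simp add: tree_def)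
qed

lemma number_of_children:
  assumes "v \<in> dendrimer_verts l k"
  shows "out_degree (with_proj (rooted_dendrimer l k)) v =
    (if length v = l then 0 else if v = [] then k else k - 1)"
proof -
  let ?m = "if v = [] then k else k - 1"
  have len: "length v \<le> l"
    using assms by (simp add: dendrimer_verts_def)
  have "out_arcs (with_proj (rooted_dendrimer l k)) v =
      (if length v = l then {} else (\<lambda>c. (v, v @ [c])) ` {..<?m})"
  proof (rule Set.set_eqI)
    fix e :: "nat list \<times> nat list"
    obtain u w where e: "e = (u, w)" by (cases e)
    show "e \<in> out_arcs (with_proj (rooted_dendrimer l k)) v \<longleftrightarrow>
      e \<in> (if length v = l then {} else (\<lambda>c. (v, v @ [c])) ` {..<?m})"
      using assms len
      by (auto simp: e out_arcs_def rooted_dendrimer_arcs snoc_dendrimer_verts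
          snoc_dendrimer_verts[of "[]", simplified])
  qed
  moreover have "inj_on (\<lambda>c. (v, v @ [c])) {..<?m}"
    by (auto simp: inj_on_def)
  ultimately show ?thesis
    by (simp add: out_degree_def card_image)
qed

lemma degree_dendrimer:
  assumes "v \<in> dendrimer_verts l k" "1 \<le> l" "2 \<le> k"
  shows "out_degree (with_proj (dendrimer l k)) v = (if length v < l then k else 1)"
proof -
  let ?T = "with_proj (rooted_dendrimer l k)"
  let ?P = "if v = [] then {} else {(v, butlast v)}"
  interpret G: pair_graph "dendrimer l k" by (rule pair_graph_dendrimer)
  have parent: "(w, v) \<in> parcs (rooted_dendrimer l k) \<longleftrightarrow> v \<noteq> [] \<and> w = butlast v" for w
    using assms(1) by (cases v rule: rev_cases) (auto simp: rooted_dendrimer_arcs)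
  have eq: "out_arcs (with_proj (dendrimer l k)) v = out_arcs ?T v \<union> ?P"
  proof (rule Set.set_eqI)
    fix e :: "nat list \<times> nat list"
    obtain u w where e: "e = (u, w)" by (cases e)
    show "e \<in> out_arcs (with_proj (dendrimer l k)) v \<longleftrightarrow> e \<in> out_arcs ?T v \<union> ?P"
      by (cases "u = v") (simp_all add: e out_arcs_def parcs_dendrimer parent)
  qed
  have "finite (out_arcs ?T v)"
    using eq G.finite_out_arcs[of v] by simp
  moreover have "(v, butlast v) \<notin> out_arcs ?T v"
    by (auto simp: out_arcs_def rooted_dendrimer_arcs dest: arg_cong[of _ _ length])
  ultimately have "card (out_arcs ?T v \<union> ?P) = out_degree ?T v + (if v = [] then 0 else 1)"
    by (simp add: out_degree_def)
  moreover have "length v \<le> l"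
    using assms(1) by (simp add: dendrimer_verts_def)
  ultimately show ?thesis
    using assms
    by (auto simp: out_degree_def[of "with_proj (dendrimer l k)"] eq number_of_children)
qed

end

theory Submission
  imports Defs
begin

text \<open>
  For real \<open>x \<ge> k\<close> all \<open>W\<^sub>j(x)\<close>, \<open>j \<le> l\<close>, are positive, so it suffices to compute \<open>det (xI - A)\<close> at
  such \<open>x\<close>. Eliminating the vertices from the leaves up to the root leaves in level \<open>i\<close> the pivot
  \<open>d\<^sub>i = x - c\<^sub>i / d\<^sub>i\<^sub>+\<^sub>1\<close>, where \<open>c\<^sub>i\<close> is the number of children; the recursion of the \<open>W\<^sub>j\<close> says that
  \<open>d\<^sub>i = W\<^sub>l\<^sub>+\<^sub>1\<^sub>-\<^sub>i(x) / W\<^sub>l\<^sub>-\<^sub>i(x)\<close>. The determinant is the product of the pivots, which telescopes to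
  the claimed formula since level \<open>i \<ge> 1\<close> has \<open>k(k-1)\<^sup>i\<^sup>-\<^sup>1\<close> vertices.
\<close>

section \<open>The determinant of a rooted forest\<close>

text \<open>In the Leibniz expansion, a nonzero term of \<open>p\<close> forces \<open>h i\<close>
  \<le> \<open>h (p i)\<close> everywhere, strictly wherever \<open>p\<close> moves
  \<open>i\<close>. As \<open>p\<close> preserves the sum of \<open>h\<close>, only the identity
  remains. With \<open>h\<close> the level, no reordering of the vertices is needed.\<close>

lemma det_triangular_wrt_height:
  fixes A :: "'a :: comm_ring_1 mat" and h :: "nat \<Rightarrow> nat"
  assumes A: "A \<in> carrier_mat n n"
    and h: "\<And>i j. i < n \<Longrightarrow> j < n \<Longrightarrow> i \<noteq> j \<Longrightarrow> A $$ (i, j) \<noteq> 0 \<Longrightarrow> h i < h j"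
  shows "det A = (\<Prod>i<n. A $$ (i, i))"
proof -
  let ?f = "\<lambda>p. signof p * (\<Prod>i = 0..<n. A $$ (i, p i))"
  have zero: "?f p = 0" if p: "p permutes {0..<n}" and "p \<noteq> id" for p
  proof (rule ccontr)
    assume "?f p \<noteq> 0"
    then have nz: "A $$ (i, p i) \<noteq> 0" if "i \<in> {0..<n}" for i
      using that by (metis prod_zero mult_zero_right finite_atLeastLessThan)
    have le: "h i \<le> h (p i)" if "i \<in> {0..<n}" for i
      using h[of i "p i"] nz[OF that] permutes_in_image[OF p, of i] that
      by (cases "p i = i") auto
    obtain i where i: "p i \<noteq> i" using \<open>p \<noteq> id\<close> by (auto simp: fun_eq_iff)
    then have iin: "i \<in> {0..<n}" using p by (meson permutes_not_in)
    then have "h i < h (p i)"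
      using h[of i "p i"] nz[OF iin] permutes_in_image[OF p, of i] i by auto
    then have "sum h {0..<n} < (\<Sum>i = 0..<n. h (p i))"
      using le iin by (intro sum_strict_mono_ex1) auto
    moreover have "(\<Sum>i = 0..<n. h (p i)) = sum h {0..<n}"
      using sum.permute[OF p, of h] by (simp add: comp_def)
    ultimately show False by simp
  qed
  have "det A = (\<Sum>p | p permutes {0..<n}. ?f p)"
    by (rule det_def'[OF A])
  also have "\<dots> = (\<Sum>p \<in> {id}. ?f p)"
    by (rule sum.mono_neutral_right) (auto simp: finite_permutations permutes_id zero)
  finally show ?thesis by (simp add: lessThan_atLeast0)
qed

text \<open>
  Elimination amounts to a factorization \<open>L D L\<^sup>T\<close>, where \<open>D\<close> is the diagonal matrix of the pivots
  and \<open>L\<close> has the entries \<open>-1 / d v\<close> at \<open>(u, v)\<close> for \<open>u\<close> the parent of \<open>v\<close>.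
\<close>

lemma det_rooted_forest:
  fixes d :: "'a \<Rightarrow> 'b :: field" and child :: "'a \<Rightarrow> 'a \<Rightarrow> bool" and h :: "'a \<Rightarrow> nat"
  assumes dist: "distinct vs"
    and parent: "\<And>u v w. child u v \<Longrightarrow> child w v \<Longrightarrow> u = w"
    and height: "\<And>u v. child u v \<Longrightarrow> h u < h v"
    and nz: "\<And>u v. v \<in> set vs \<Longrightarrow> child u v \<Longrightarrow> d v \<noteq> 0"
    and pivot: "\<And>u. u \<in> set vs \<Longrightarrow> d u = x - (\<Sum>v | v \<in> set vs \<and> child u v. 1 / d v)"
  shows "det (mat (length vs) (length vs) (\<lambda>(i, j).
      if i = j then x else if child (vs ! i) (vs ! j) \<or> child (vs ! j) (vs ! i) then - 1 else 0)) =
    (\<Prod>v\<in>set vs. d v)" (is "det ?M = _")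
proof -
  let ?n = "length vs"
  define E where "E u v = (if u = v then 1 else if child u v then - 1 / d v else 0)" for u v
  define L where "L = mat ?n ?n (\<lambda>(i, j). E (vs ! i) (vs ! j))"
  \<comment> \<open>\<open>R\<close> is \<open>L D\<close>, so that \<open>L R^T\<close> =
    \<open>L D L^T\<close>.\<close>
  define R where "R = mat ?n ?n (\<lambda>(i, j). E (vs ! i) (vs ! j) * d (vs ! j))"
  have irrefl: "\<not> child u u" for u using height by blast
  have asym: "\<not> child w u" if "child u w" for u w using height[OF that] height[of w u] by auto
  have sums: "(\<Sum>v\<in>set vs. E u v * (E w v * d v)) =
      (if u = w then x else if child u w \<or> child w u then - 1 else 0)"
    if u: "u \<in> set vs" and w: "w \<in> set vs" for u w
  proof -
    \<comment> \<open>A summand can be nonzero only at \<open>v = u\<close>, at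
      \<open>v = w\<close>, or at a common child of \<open>u\<close> and \<open>w\<close>. Since
      parents are unique, the last case forces \<open>u = w\<close> and contributes
      \<open>1 / d v\<close>.\<close>
    have "(\<Sum>v\<in>set vs. E u v * (E w v * d v)) = (\<Sum>v\<in>set vs.
        (if v = u then (if u = w then d u else 0) - (if child w u then 1 else 0) else 0)
        - (if v = w then (if child u w then 1 else 0) else 0)
        + (if child u v then (if u = w then 1 / d v else 0) else 0))"
      by (rule sum.cong) (auto simp: E_def nz irrefl asym dest: parent)
    also have "\<dots> = (if u = w then d u else 0) - (if child w u then 1 else 0)
        - (if child u w then 1 else 0)
        + (\<Sum>v | v \<in> set vs \<and> child u v. if u = w then 1 / d v else 0)"
      using u w by (simp add: sum.distrib sum_subtractf sum.inter_filter)
    also have "\<dots> = (if u = w then x else if child u w \<or> child w u then - 1 else 0)"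
      using pivot[OF u] by (auto simp: irrefl asym)
    finally show ?thesis .
  qed
  have carr: "L \<in> carrier_mat ?n ?n" "R \<in> carrier_mat ?n ?n"
    by (auto simp: L_def R_def)
  have "?M = L * R\<^sup>T"
  proof (rule eq_matI)
    fix i j assume "i < dim_row (L * R\<^sup>T)" "j < dim_col (L * R\<^sup>T)"
    then have ij: "i < ?n" "j < ?n" using carr by auto
    have "(L * R\<^sup>T) $$ (i, j) = (\<Sum>m = 0..<?n. E (vs ! i) (vs ! m) * (E (vs ! j) (vs ! m) * d (vs ! m)))"
      using ij by (simp add: L_def R_def scalar_prod_def)
    also have "\<dots> = (\<Sum>v\<in>set vs. E (vs ! i) v * (E (vs ! j) v * d v))"
      using bij_betw_nth[OF dist refl refl]
      by (intro sum.reindex_bij_betw) (simp add: lessThan_atLeast0)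
    finally show "?M $$ (i, j) = (L * R\<^sup>T) $$ (i, j)"
      using ij dist by (simp add: sums nth_eq_iff_index_eq)
  qed (use carr in auto)
  then have "det ?M = det L * det R"
    using carr by (simp add: det_mult[of L ?n] det_transpose)
  also have "det L = (\<Prod>i<?n. L $$ (i, i))"
    by (rule det_triangular_wrt_height[where h = "\<lambda>i. h (vs ! i)"])
      (use dist in \<open>auto simp: L_def E_def nth_eq_iff_index_eq height split: if_splits\<close>)
  also have "\<dots> = 1" by (simp add: L_def E_def)
  also have "det R = (\<Prod>i<?n. R $$ (i, i))"
    by (rule det_triangular_wrt_height[where h = "\<lambda>i. h (vs ! i)"])
      (use dist in \<open>auto simp: R_def E_def nth_eq_iff_index_eq height split: if_splits\<close>)
  also have "\<dots> = (\<Prod>i<?n. d (vs ! i))" by (simp add: R_def E_def)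
  also have "\<dots> = (\<Prod>v\<in>set vs. d v)"
    by (rule prod.reindex_bij_betw) (rule bij_betw_nth[OF dist refl refl])
  finally show ?thesis by simp
qed

section \<open>Levels of the dendrimer\<close>

lemma dendrimer_level_Suc:
  assumes "i < l"
  shows "{v \<in> dendrimer_verts l k. length v = Suc i} =
    (\<lambda>(u, c). u @ [c]) `
      ({v \<in> dendrimer_verts l k. length v = i} \<times> {..<if i = 0 then k else k - 1})"
    (is "?A = ?B")
proof (intro equalityI subsetI)
  fix v assume "v \<in> ?A"
  then show "v \<in> ?B"
    by (cases v rule: rev_cases) (auto simp: snoc_dendrimer_verts image_iff)
next
  fix v assume "v \<in> ?B"
  then show "v \<in> ?A"
    using assms by (auto simp: snoc_dendrimer_verts)
qed

lemma card_dendrimer_level: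
  assumes "i \<le> l"
  shows "card {v \<in> dendrimer_verts l k. length v = i} = (if i = 0 then 1 else k * (k - 1) ^ (i - 1))"
  using assms
proof (induction i)
  case 0
  have "{v \<in> dendrimer_verts l k. length v = 0} = {[]}" by auto
  then show ?case by simp
next
  case (Suc i)
  have "card {v \<in> dendrimer_verts l k. length v = Suc i} =
      card {v \<in> dendrimer_verts l k. length v = i} * (if i = 0 then k else k - 1)"
    using Suc.prems
    by (subst dendrimer_level_Suc) (auto simp: card_image inj_on_def card_cartesian_product)
  then show ?case
    using Suc by (cases i) auto
qed

text \<open>Used for the pivots, which depend only on the level. The root stands apart because the
  size of its level does not follow the geometric pattern.\<close>

lemma prod_dendrimer_verts:
  "(\<Prod>v\<in>dendrimer_verts l k. f (length v)) =
    f 0 * (\<Prod>i = 1..l. f i ^ (k * (k - 1) ^ (i - 1)))"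
  for f :: "nat \<Rightarrow> 'a :: comm_monoid_mult"
proof -
  have "(\<Prod>v\<in>dendrimer_verts l k. f (length v)) =
      (\<Prod>i = 0..l. \<Prod>v | v \<in> dendrimer_verts l k \<and> length v = i. f (length v))"
    by (rule prod.group[OF finite_dendrimer_verts, symmetric]) (auto simp: dendrimer_verts_def)
  also have "\<dots> = (\<Prod>i = 0..l. f i ^ (if i = 0 then 1 else k * (k - 1) ^ (i - 1)))"
    by (rule prod.cong) (simp_all add: card_dendrimer_level)
  also have "\<dots> = f 0 * (\<Prod>i = 1..l. f i ^ (k * (k - 1) ^ (i - 1)))"
    by (subst prod.atLeast_Suc_atMost) (auto intro!: arg_cong2[of _ _ _ _ "(*)"] prod.cong)
  finally show ?thesis .
qed

section \<open>The pivots\<close>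

text \<open>Positivity alone does not survive the subtraction in the recursion, so the induction
  also carries monotonicity in \<open>j\<close>: the increment
  \<open>(x - 1) W_(j+1) - (k - 1) W_j\<close> is nonnegative.\<close>

lemma poly_W_pos:
  assumes "k \<ge> 2" and "x \<ge> real k" and "j \<le> l"
  shows "poly (W l k j) x > 0"
proof -
  have "0 < poly (W l k j) x \<and> (j < l \<longrightarrow> poly (W l k j) x \<le> poly (W l k (Suc j)) x)"
    using assms(3)
  proof (induction j)
    case 0
    then show ?case using assms by simp
  next
    case (Suc j)
    let ?a = "poly (W l k j) x" and ?b = "poly (W l k (Suc j)) x"
    have pos: "0 < ?a" "?a \<le> ?b" using Suc by auto
    moreover have "?b \<le> poly (W l k (Suc (Suc j))) x" if "Suc j < l"
    proof -
      have "(real k - 1) * ?a \<le> (x - 1) * ?b"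
        using assms pos by (intro mult_mono) auto
      then show ?thesis using that by (simp add: algebra_simps)
    qed
    ultimately show ?case by auto
  qed
  then show ?thesis ..
qed

text \<open>Telescoping: \<open>w j\<close> has exponent \<open>k * m ^ (l - j)\<close> as a
  numerator and, for \<open>j < l\<close>, exponent \<open>k * m ^ (l - 1 - j)\<close> as the
  denominator of the next factor.\<close>

lemma prod_quotient_powers:
  fixes w :: "nat \<Rightarrow> 'a :: field" and k m :: nat
  assumes "w 0 = 1" and "\<And>j. j \<le> l \<Longrightarrow> w j \<noteq> 0" and "l \<ge> 1" and "m \<ge> 1"
  shows "(\<Prod>j = 1..l. (w j / w (j - 1)) ^ (k * m ^ (l - j))) =
    w l ^ k * (\<Prod>j = 1..l - 1. w j ^ (k * (m - 1) * m ^ (l - 1 - j)))"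
  using assms(3) assms(2)
proof (induction l rule: dec_induct)
  case base
  then show ?case using assms(1) by simp
next
  case (step l)
  \<comment> \<open>Passing from \<open>l\<close> to \<open>Suc l\<close> multiplies every old
    exponent by \<open>m\<close>, so the old product is raised to the power
    \<open>m\<close>.\<close>
  have exp: "(\<Prod>j = 1..l. (w j / w (j - 1)) ^ (k * m ^ (Suc l - j))) =
      (\<Prod>j = 1..l. (w j / w (j - 1)) ^ (k * m ^ (l - j))) ^ m"
    unfolding prod_power_distrib
    by (rule prod.cong) (simp_all add: Suc_diff_le power_mult[symmetric] mult_ac)
  have "(\<Prod>j = 1..Suc l. (w j / w (j - 1)) ^ (k * m ^ (Suc l - j))) =
      (\<Prod>j = 1..l. (w j / w (j - 1)) ^ (k * m ^ (l - j))) ^ m * (w (Suc l) / w l) ^ k"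
    using exp by simp
  also have "\<dots> = w (Suc l) ^ k * (w l ^ (k * m) / w l ^ k) *
      (\<Prod>j = 1..l - 1. w j ^ (k * (m - 1) * m ^ (l - 1 - j))) ^ m"
    using step by (simp add: power_mult_distrib power_divide power_mult)
  also have "w l ^ (k * m) / w l ^ k = w l ^ (k * (m - 1))"
    using step.prems[of l] assms(4) by (subst power_diff[symmetric]) (simp_all add: algebra_simps)
  also have "(\<Prod>j = 1..l - 1. w j ^ (k * (m - 1) * m ^ (l - 1 - j))) ^ m =
      (\<Prod>j = 1..l - 1. w j ^ (k * (m - 1) * m ^ (l - j)))"
    unfolding prod_power_distrib
  proof (rule prod.cong[OF refl])
    fix j assume "j \<in> {1..l - 1}"
    then have "l - j = Suc (l - 1 - j)" by auto
    then show "(w j ^ (k * (m - 1) * m ^ (l - 1 - j))) ^ m = w j ^ (k * (m - 1) * m ^ (l - j))"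
      by (simp add: power_mult[symmetric] mult_ac)
  qed
  also have "w (Suc l) ^ k * w l ^ (k * (m - 1)) * (\<Prod>j = 1..l - 1. w j ^ (k * (m - 1) * m ^ (l - j))) =
      w (Suc l) ^ k * (\<Prod>j = 1..l. w j ^ (k * (m - 1) * m ^ (l - j)))"
    using step.hyps by (cases l) simp_all
  finally show ?case by simp
qed

lemma poly_char_poly_dendrimer:
  assumes k: "k \<ge> 2" and l: "l \<ge> 1" and x: "x \<ge> real k"
    and vs: "distinct vs" "set vs = pverts (dendrimer l k)"
  shows "poly (char_poly (adjacency_matrix (dendrimer l k) vs)) x =
    (\<Prod>v\<in>dendrimer_verts l k. poly (W l k (l + 1 - length v)) x / poly (W l k (l - length v)) x)"
proof -
  let ?V = "dendrimer_verts l k" and ?A = "adjacency_matrix (dendrimer l k) vs"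
  let ?w = "\<lambda>j. poly (W l k j) x"
  let ?child = "\<lambda>u v. (u, v) \<in> parcs (rooted_dendrimer l k)"
  define d where "d v = ?w (l + 1 - length v) / ?w (l - length v)" for v :: "nat list"
  have V: "set vs = ?V" using vs by simp
  have pos: "?w j > 0" if "j \<le> l" for j using poly_W_pos[OF k x that] .
  have children: "card {v. v \<in> ?V \<and> ?child u v} =
      (if length u = l then 0 else if u = [] then k else k - 1)" if "u \<in> ?V" for u
  proof -
    have "out_arcs (with_proj (rooted_dendrimer l k)) u = Pair u ` {v. v \<in> ?V \<and> ?child u v}"
      by (auto simp: out_arcs_def rooted_dendrimer_arcs)
    then show ?thesis
      using number_of_children[OF that] by (simp add: out_degree_def card_image inj_on_def)
  qed
  have pivot: "d u = x - (\<Sum>v | v \<in> ?V \<and> ?child u v. 1 / d v)" if u: "u \<in> ?V" for u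
  proof -
    have len: "length u \<le> l" using u by (simp add: dendrimer_verts_def)
    let ?j = "l - length u"
    \<comment> \<open>A child lies one level deeper, so the numerator of its pivot is the
      denominator of the pivot of \<open>u\<close>.\<close>
    have "(\<Sum>v | v \<in> ?V \<and> ?child u v. 1 / d v) = (\<Sum>v | v \<in> ?V \<and> ?child u v. ?w (?j - 1) / ?w ?j)"
      by (rule sum.cong) (auto simp: d_def rooted_dendrimer_arcs)
    also have "\<dots> = real (if length u = l then 0 else if u = [] then k else k - 1) * (?w (?j - 1) / ?w ?j)"
      using children[OF u] by simp
    also have "\<dots> = x - d u"
    proof (cases "length u = l")
      case True
      then show ?thesis by (simp add: d_def)
    next
      case False
      with len obtain j where j: "?j = Suc j" by (cases ?j) auto
      then have "l + 1 - length u = Suc (Suc j)" by auto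
      then have du: "d u = ?w (Suc (Suc j)) / ?w (Suc j)" by (simp only: d_def j)
      \<comment> \<open>The exceptional last step of the recursion, with \<open>k\<close> in place
        of \<open>k - 1\<close>, occurs exactly at the root, which has \<open>k\<close>
        children.\<close>
      have "u = [] \<longleftrightarrow> \<not> Suc (Suc j) \<le> l" using j len by (cases u) auto
      then have "?w (Suc (Suc j)) = x * ?w (Suc j) - real (if u = [] then k else k - 1) * ?w j"
        using k by (simp add: of_nat_diff)
      moreover have "?w (Suc j) \<noteq> 0" using pos[of "Suc j"] j by fastforce
      ultimately show ?thesis using False by (simp add: du j field_simps)
    qed
    finally show ?thesis by simp
  qed
  \<comment> \<open>A child is not the root, so both indices in its pivot are at most
    \<open>l\<close>, where \<open>W\<close> is known to be positive.\<close>
  have nz: "d v \<noteq> 0" if "v \<in> ?V" "?child u v" for u v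
  proof -
    have "l + 1 - length v \<le> l" using that by (auto simp: rooted_dendrimer_arcs)
    then show ?thesis
      using pos[of "l + 1 - length v"] pos[of "l - length v"] by (simp add: d_def)
  qed
  have "poly (char_poly ?A) x = det (- char_matrix ?A x)"
    by (rule char_poly_matrix[of _ "length vs"]) (simp add: adjacency_matrix_def)
  also have "- char_matrix ?A x = mat (length vs) (length vs) (\<lambda>(i, j).
      if i = j then x else if ?child (vs ! i) (vs ! j) \<or> ?child (vs ! j) (vs ! i) then - 1 else 0)"
    by (rule eq_matI)
      (auto simp: char_matrix_def adjacency_matrix_def parcs_dendrimer rooted_dendrimer_arcs)
  also have "det \<dots> = (\<Prod>v\<in>set vs. d v)"
  proof (rule det_rooted_forest[where h = length])
    show "distinct vs" by (fact vs(1))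
    show "u = w" if "?child u v" "?child w v" for u v w
      using that by (auto simp: rooted_dendrimer_arcs)
    show "length u < length v" if "?child u v" for u v
      using that by (auto simp: rooted_dendrimer_arcs)
  qed (use nz pivot V in auto)
  finally show ?thesis by (simp add: V d_def)
qed

text \<open>A nonzero difference has finitely many roots, but a ray is infinite. This turns the
  computation at \<open>x\<close> \<ge> \<open>k\<close> into an identity of polynomials.\<close>

lemma poly_eqI_ge:
  fixes p q :: "real poly"
  assumes "\<And>x. x \<ge> c \<Longrightarrow> poly p x = poly q x"
  shows "p = q"
proof (rule ccontr)
  assume "p \<noteq> q"
  then have "finite {x. poly (p - q) x = 0}" by (intro poly_roots_finite) simp
  moreover have "{c..} \<subseteq> {x. poly (p - q) x = 0}" using assms by auto
  ultimately show False using infinite_Ici finite_subset by blast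
qed

theorem theorem6:
  fixes l k :: nat and vs :: "nat list list"
  assumes "k \<ge> 2" and "l \<ge> 1"
    and "distinct vs" and "set vs = pverts (dendrimer l k)"
  shows "char_poly (adjacency_matrix (dendrimer l k) vs) =
    W l k (l + 1) * W l k l ^ (k - 1) *
    (\<Prod>j = 1..l - 1. W l k j ^ (k * (k - 2) * (k - 1) ^ (l - 1 - j)))"
proof (rule poly_eqI_ge)
  fix x assume x: "x \<ge> real k"
  let ?w = "\<lambda>j. poly (W l k j) x"
  have nz: "?w j \<noteq> 0" if "j \<le> l" for j
    using poly_W_pos[OF assms(1) x that] by simp
  have "poly (char_poly (adjacency_matrix (dendrimer l k) vs)) x =
      ?w (l + 1) / ?w l * (\<Prod>i = 1..l. (?w (l + 1 - i) / ?w (l - i)) ^ (k * (k - 1) ^ (i - 1)))"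
    unfolding poly_char_poly_dendrimer[OF assms(1,2) x assms(3,4)]
    by (subst prod_dendrimer_verts) simp
  \<comment> \<open>Levels are now counted from the leaves, by \<open>j = l + 1 - i\<close>.\<close>
  also have "(\<Prod>i = 1..l. (?w (l + 1 - i) / ?w (l - i)) ^ (k * (k - 1) ^ (i - 1))) =
      (\<Prod>j = 1..l. (?w j / ?w (j - 1)) ^ (k * (k - 1) ^ (l - j)))"
    by (rule prod.reindex_bij_witness[of _ "\<lambda>j. l + 1 - j" "\<lambda>i. l + 1 - i"]) auto
  also have "\<dots> = ?w l ^ k * (\<Prod>j = 1..l - 1. ?w j ^ (k * (k - 1 - 1) * (k - 1) ^ (l - 1 - j)))"
    using assms nz by (intro prod_quotient_powers) auto
  \<comment> \<open>The denominator of the root's pivot cancels one of the \<open>k\<close> factors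
    \<open>?w l\<close>.\<close>
  also have "?w (l + 1) / ?w l * \<dots> = ?w (l + 1) * ?w l ^ (k - 1) *
      (\<Prod>j = 1..l - 1. ?w j ^ (k * (k - 2) * (k - 1) ^ (l - 1 - j)))"
    using nz[of l] assms(1) by (cases k) (simp_all add: numeral_2_eq_2)
  finally show "poly (char_poly (adjacency_matrix (dendrimer l k) vs)) x =
      poly (W l k (l + 1) * W l k l ^ (k - 1) *
        (\<Prod>j = 1..l - 1. W l k j ^ (k * (k - 2) * (k - 1) ^ (l - 1 - j)))) x"
    by (simp add: poly_prod poly_power)
qed

end
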